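(* Let $R$ be a commutative unital ring, $S\subset R$ a multiplicatively closed set, $I_\bullet$ a filtration of $R$ by ideals, and $I_\infty:=\bigcap_jI_j$. Let $I_\bullet[S^{-1}]\subset R[S^{-1}]$ be the image of the filtration under the localization. Suppose $I_\infty\cap S=\varnothing$ and for any $q\in S$ there exists $\tau_q\in I_\infty$ such that $1+\tau_q\in(q)\subset R$. Then the completion map $R\to\widehat R^{(I_\bullet)}$ is surjective if and only if the completion map $R[S^{-1}]\to\widehat{R[S^{-1}]}^{(I_\bullet[S^{-1}])}$ is surjective.
   Context: A filtration of a ring $R$ is a decreasing sequence of ideals $R=I_0\supseteq I_1\supseteq\cdots$. The completion is $\widehat R^{(I_\bullet)}:=\varprojlim_jR/I_j$ with its natural map from $R$. $I_j[S^{-1}]$ is the ideal of $R[S^{-1}]$ consisting of fractions $a/s$ with $a\in I_j$, $s\in S$. *)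

theory Defs
  imports "HOL-Algebra.QuotRing"
begin

section \<open>Localization of a commutative ring at a multiplicatively closed set\<close>

definition loc_rel :: "('a, 'm) ring_scheme \<Rightarrow> 'a set \<Rightarrow> (('a \<times> 'a) \<times> ('a \<times> 'a)) set"
  where "loc_rel R S =
    {((a, s), (b, t)). a \<in> carrier R \<and> s \<in> S \<and> b \<in> carrier R \<and> t \<in> S \<and>
       (\<exists>u\<in>S. u \<otimes>\<^bsub>R\<^esub> (a \<otimes>\<^bsub>R\<^esub> t) = u \<otimes>\<^bsub>R\<^esub> (b \<otimes>\<^bsub>R\<^esub> s))}"

definition loc_frac :: "('a, 'm) ring_scheme \<Rightarrow> 'a set \<Rightarrow> 'a \<Rightarrow> 'a \<Rightarrow> ('a \<times> 'a) set"
  where "loc_frac R S a s = loc_rel R S `` {(a, s)}"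

definition localization :: "('a, 'm) ring_scheme \<Rightarrow> 'a set \<Rightarrow> ('a \<times> 'a) set ring"
  where "localization R S =
    \<lparr>carrier = (carrier R \<times> S) // loc_rel R S,
     mult = (\<lambda>A B. \<Union>(a, s)\<in>A. \<Union>(b, t)\<in>B.
              loc_frac R S (a \<otimes>\<^bsub>R\<^esub> b) (s \<otimes>\<^bsub>R\<^esub> t)),
     one = loc_frac R S \<one>\<^bsub>R\<^esub> \<one>\<^bsub>R\<^esub>,
     zero = loc_frac R S \<zero>\<^bsub>R\<^esub> \<one>\<^bsub>R\<^esub>,
     add = (\<lambda>A B. \<Union>(a, s)\<in>A. \<Union>(b, t)\<in>B.
             loc_frac R S ((a \<otimes>\<^bsub>R\<^esub> t) \<oplus>\<^bsub>R\<^esub> (b \<otimes>\<^bsub>R\<^esub> s)) (s \<otimes>\<^bsub>R\<^esub> t))\<rparr>"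

definition loc_ideal :: "('a, 'm) ring_scheme \<Rightarrow> 'a set \<Rightarrow> 'a set \<Rightarrow> ('a \<times> 'a) set set"
  where "loc_ideal R S J = {loc_frac R S a s | a s. a \<in> J \<and> s \<in> S}"


section \<open>Filtrations and completions\<close>

definition filtration :: "('a, 'm) ring_scheme \<Rightarrow> (nat \<Rightarrow> 'a set) \<Rightarrow> bool"
  where "filtration R I \<longleftrightarrow>
    I 0 = carrier R \<and> (\<forall>j. ideal (I j) R) \<and> (\<forall>j. I (Suc j) \<subseteq> I j)"

text \<open>
  For ideals \<open>J \<subseteq> K\<close> the canonical projection \<open>R/J \<rightarrow> R/K\<close> sends the coset \<open>A\<close> to \<open>K + A\<close>;
  see \<open>transition_coset\<close> below.
\<close>

definition transition :: "('a, 'm) ring_scheme \<Rightarrow> 'a set \<Rightarrow> 'a set \<Rightarrow> 'a set"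
  where "transition R K A = K <+>\<^bsub>R\<^esub> A"

definition completion :: "('a, 'm) ring_scheme \<Rightarrow> (nat \<Rightarrow> 'a set) \<Rightarrow> (nat \<Rightarrow> 'a set) ring"
  where "completion R I =
    \<lparr>carrier = {x. (\<forall>j. x j \<in> carrier (R Quot I j)) \<and>
                   (\<forall>i j. i \<le> j \<longrightarrow> transition R (I i) (x j) = x i)},
     mult = (\<lambda>x y j. x j \<otimes>\<^bsub>R Quot I j\<^esub> y j),
     one = (\<lambda>j. \<one>\<^bsub>R Quot I j\<^esub>),
     zero = (\<lambda>j. \<zero>\<^bsub>R Quot I j\<^esub>),
     add = (\<lambda>x y j. x j \<oplus>\<^bsub>R Quot I j\<^esub> y j)\<rparr>"

definition completion_map :: "('a, 'm) ring_scheme \<Rightarrow> (nat \<Rightarrow> 'a set) \<Rightarrow> 'a \<Rightarrow> nat \<Rightarrow> 'a set"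
  where "completion_map R I a = (\<lambda>j. I j +>\<^bsub>R\<^esub> a)"


section \<open>The localization is a commutative ring\<close>

locale mult_closed = cring R + submonoid S R for R (structure) and S
begin

lemma S_carr [simp]: "s \<in> S \<Longrightarrow> s \<in> carrier R"
  using subset by blast

lemma loc_rel_iff:
  "((a, s), (b, t)) \<in> loc_rel R S \<longleftrightarrow>
    a \<in> carrier R \<and> s \<in> S \<and> b \<in> carrier R \<and> t \<in> S \<and>
    (\<exists>u\<in>S. u \<otimes> (a \<otimes> t) = u \<otimes> (b \<otimes> s))"
  by (simp add: loc_rel_def)

lemma equiv_loc_rel: "equiv (carrier R \<times> S) (loc_rel R S)"
proof (rule equivI)
  show "loc_rel R S \<subseteq> (carrier R \<times> S) \<times> (carrier R \<times> S)"
    by (auto simp: loc_rel_def)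
  show "refl_on (carrier R \<times> S) (loc_rel R S)"
    by (auto simp: refl_on_def loc_rel_def intro: one_closed)
  show "sym (loc_rel R S)"
    by (auto simp: sym_def loc_rel_def dest: sym)
  show "trans (loc_rel R S)"
  proof (rule transI, clarify)
    fix a s b t c r
    assume "((a, s), (b, t)) \<in> loc_rel R S" "((b, t), (c, r)) \<in> loc_rel R S"
    then obtain u v where
      C: "a \<in> carrier R" "b \<in> carrier R" "c \<in> carrier R" "s \<in> S" "t \<in> S" "r \<in> S" "u \<in> S" "v \<in> S"
      and E1: "u \<otimes> (a \<otimes> t) = u \<otimes> (b \<otimes> s)" and E2: "v \<otimes> (b \<otimes> r) = v \<otimes> (c \<otimes> t)"
      by (auto simp: loc_rel_iff)
    note K = C(1-3) C(4-8)[THEN S_carr]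
    have "(u \<otimes> v \<otimes> t) \<otimes> (a \<otimes> r) = (u \<otimes> (a \<otimes> t)) \<otimes> (v \<otimes> r)"
      using K by algebra
    also have "\<dots> = (v \<otimes> (b \<otimes> r)) \<otimes> (u \<otimes> s)"
      using K unfolding E1 by algebra
    also have "\<dots> = (u \<otimes> v \<otimes> t) \<otimes> (c \<otimes> s)"
      using K unfolding E2 by algebra
    finally show "((a, s), (c, r)) \<in> loc_rel R S"
      using C by (auto simp: loc_rel_iff intro!: bexI[of _ "u \<otimes> v \<otimes> t"])
  qed
qed

lemma loc_frac_eq_iff:
  assumes "a \<in> carrier R" "s \<in> S" "b \<in> carrier R" "t \<in> S"
  shows "loc_frac R S a s = loc_frac R S b t \<longleftrightarrow> (\<exists>u\<in>S. u \<otimes> (a \<otimes> t) = u \<otimes> (b \<otimes> s))"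
  using eq_equiv_class_iff[OF equiv_loc_rel, of "(a, s)" "(b, t)"] assms
  by (simp add: loc_frac_def loc_rel_iff)

lemma loc_frac_eqI:
  assumes "a \<in> carrier R" "s \<in> S" "b \<in> carrier R" "t \<in> S" "a \<otimes> t = b \<otimes> s"
  shows "loc_frac R S a s = loc_frac R S b t"
  using assms by (auto simp: loc_frac_eq_iff)

lemma carrier_localization:
  "carrier (localization R S) = {loc_frac R S a s | a s. a \<in> carrier R \<and> s \<in> S}"
  by (auto simp: localization_def quotient_def loc_frac_def)

lemma loc_frac_mult:
  assumes "a \<in> carrier R" "s \<in> S" "b \<in> carrier R" "t \<in> S"
  shows "loc_frac R S a s \<otimes>\<^bsub>localization R S\<^esub> loc_frac R S b t = loc_frac R S (a \<otimes> b) (s \<otimes> t)"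
proof -
  have "(\<lambda>(a, s) (b, t). loc_frac R S (a \<otimes> b) (s \<otimes> t)) respects2 loc_rel R S"
  proof (rule congruent2I', clarify)
    fix a s a' s' b t b' t'
    assume "((a, s), (a', s')) \<in> loc_rel R S" "((b, t), (b', t')) \<in> loc_rel R S"
    then obtain u v where
      C: "a \<in> carrier R" "a' \<in> carrier R" "b \<in> carrier R" "b' \<in> carrier R"
        "s \<in> S" "s' \<in> S" "t \<in> S" "t' \<in> S" "u \<in> S" "v \<in> S"
      and E: "u \<otimes> (a \<otimes> s') = u \<otimes> (a' \<otimes> s)" "v \<otimes> (b \<otimes> t') = v \<otimes> (b' \<otimes> t)"
      by (auto simp: loc_rel_iff)
    note K = C(1-4) C(5-10)[THEN S_carr]
    have "(u \<otimes> v) \<otimes> (a \<otimes> b \<otimes> (s' \<otimes> t')) = (u \<otimes> (a \<otimes> s')) \<otimes> (v \<otimes> (b \<otimes> t'))"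
      using K by algebra
    also have "\<dots> = (u \<otimes> v) \<otimes> (a' \<otimes> b' \<otimes> (s \<otimes> t))"
      using K unfolding E by algebra
    finally show "loc_frac R S (a \<otimes> b) (s \<otimes> t) = loc_frac R S (a' \<otimes> b') (s' \<otimes> t')"
      using C by (auto simp: loc_frac_eq_iff intro!: bexI[of _ "u \<otimes> v"])
  qed
  from UN_equiv_class2[OF equiv_loc_rel equiv_loc_rel this, of "(a, s)" "(b, t)"] assms
  show ?thesis by (simp add: localization_def loc_frac_def case_prod_unfold)
qed

lemma loc_frac_add:
  assumes "a \<in> carrier R" "s \<in> S" "b \<in> carrier R" "t \<in> S"
  shows "loc_frac R S a s \<oplus>\<^bsub>localization R S\<^esub> loc_frac R S b t
    = loc_frac R S ((a \<otimes> t) \<oplus> (b \<otimes> s)) (s \<otimes> t)"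
proof -
  have "(\<lambda>(a, s) (b, t). loc_frac R S ((a \<otimes> t) \<oplus> (b \<otimes> s)) (s \<otimes> t)) respects2 loc_rel R S"
  proof (rule congruent2I', clarify)
    fix a s a' s' b t b' t'
    assume "((a, s), (a', s')) \<in> loc_rel R S" "((b, t), (b', t')) \<in> loc_rel R S"
    then obtain u v where
      C: "a \<in> carrier R" "a' \<in> carrier R" "b \<in> carrier R" "b' \<in> carrier R"
        "s \<in> S" "s' \<in> S" "t \<in> S" "t' \<in> S" "u \<in> S" "v \<in> S"
      and E: "u \<otimes> (a \<otimes> s') = u \<otimes> (a' \<otimes> s)" "v \<otimes> (b \<otimes> t') = v \<otimes> (b' \<otimes> t)"
      by (auto simp: loc_rel_iff)
    note K = C(1-4) C(5-10)[THEN S_carr]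
    have "(u \<otimes> v) \<otimes> (((a \<otimes> t) \<oplus> (b \<otimes> s)) \<otimes> (s' \<otimes> t'))
      = (u \<otimes> (a \<otimes> s')) \<otimes> (v \<otimes> t \<otimes> t') \<oplus> (v \<otimes> (b \<otimes> t')) \<otimes> (u \<otimes> s \<otimes> s')"
      using K by algebra
    also have "\<dots> = (u \<otimes> v) \<otimes> (((a' \<otimes> t') \<oplus> (b' \<otimes> s')) \<otimes> (s \<otimes> t))"
      using K unfolding E by algebra
    finally show "loc_frac R S ((a \<otimes> t) \<oplus> (b \<otimes> s)) (s \<otimes> t)
      = loc_frac R S ((a' \<otimes> t') \<oplus> (b' \<otimes> s')) (s' \<otimes> t')"
      using C by (auto simp: loc_frac_eq_iff intro!: bexI[of _ "u \<otimes> v"])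
  qed
  from UN_equiv_class2[OF equiv_loc_rel equiv_loc_rel this, of "(a, s)" "(b, t)"] assms
  show ?thesis by (simp add: localization_def loc_frac_def case_prod_unfold)
qed

lemma loc_frac_one: "\<one>\<^bsub>localization R S\<^esub> = loc_frac R S \<one> \<one>"
  and loc_frac_zero: "\<zero>\<^bsub>localization R S\<^esub> = loc_frac R S \<zero> \<one>"
  by (simp_all add: localization_def)

lemma loc_frac_closed [simp]:
  "a \<in> carrier R \<Longrightarrow> s \<in> S \<Longrightarrow> loc_frac R S a s \<in> carrier (localization R S)"
  by (auto simp: carrier_localization)

lemma loc_frac_cases:
  assumes "x \<in> carrier (localization R S)"
  obtains a s where "x = loc_frac R S a s" "a \<in> carrier R" "s \<in> S"
  using assms by (auto simp: carrier_localization)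

lemma cring_localization: "cring (localization R S)"
proof (rule cringI)
  let ?L = "localization R S"
  note ops = loc_frac_add loc_frac_mult loc_frac_one loc_frac_zero
  show "abelian_group ?L"
  proof (rule abelian_groupI)
    fix x y assume "x \<in> carrier ?L" "y \<in> carrier ?L"
    then show "x \<oplus>\<^bsub>?L\<^esub> y \<in> carrier ?L"
      by (elim loc_frac_cases) (simp add: ops)
  next
    fix x y z assume "x \<in> carrier ?L" "y \<in> carrier ?L" "z \<in> carrier ?L"
    then show "(x \<oplus>\<^bsub>?L\<^esub> y) \<oplus>\<^bsub>?L\<^esub> z = x \<oplus>\<^bsub>?L\<^esub> (y \<oplus>\<^bsub>?L\<^esub> z)"
    proof (elim loc_frac_cases)
      fix a s b t c r assume H: "x = loc_frac R S a s" "y = loc_frac R S b t" "z = loc_frac R S c r"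
        "a \<in> carrier R" "b \<in> carrier R" "c \<in> carrier R" and T: "s \<in> S" "t \<in> S" "r \<in> S"
      note K = H(4-6) T[THEN S_carr]
      have E: "((a \<otimes> t \<oplus> b \<otimes> s) \<otimes> r \<oplus> c \<otimes> (s \<otimes> t)) \<otimes> (s \<otimes> (t \<otimes> r))
        = (a \<otimes> (t \<otimes> r) \<oplus> (b \<otimes> r \<oplus> c \<otimes> t) \<otimes> s) \<otimes> (s \<otimes> t \<otimes> r)"
        using K by (simp add: l_distr r_distr m_ac a_ac)
      show ?thesis using H T by (simp add: ops) (rule loc_frac_eqI, simp_all only: E; simp)
    qed
  next
    fix x y assume "x \<in> carrier ?L" "y \<in> carrier ?L"
    then show "x \<oplus>\<^bsub>?L\<^esub> y = y \<oplus>\<^bsub>?L\<^esub> x"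
      by (elim loc_frac_cases) (simp add: ops a_comm m_comm)
  next
    show "\<zero>\<^bsub>?L\<^esub> \<in> carrier ?L" by (simp add: ops)
  next
    fix x assume "x \<in> carrier ?L"
    then show "\<zero>\<^bsub>?L\<^esub> \<oplus>\<^bsub>?L\<^esub> x = x" by (elim loc_frac_cases) (simp add: ops)
  next
    fix x assume "x \<in> carrier ?L"
    then obtain a s where x: "x = loc_frac R S a s" "a \<in> carrier R" "s \<in> S" by (elim loc_frac_cases)
    have "loc_frac R S (\<ominus> a) s \<oplus>\<^bsub>?L\<^esub> x = \<zero>\<^bsub>?L\<^esub>"
      using x loc_frac_eqI[of \<zero> "s \<otimes> s" \<zero> \<one>] by (simp add: ops l_minus l_neg)
    then show "\<exists>y\<in>carrier ?L. y \<oplus>\<^bsub>?L\<^esub> x = \<zero>\<^bsub>?L\<^esub>"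
      using x by (meson a_inv_closed loc_frac_closed)
  qed
  show "comm_monoid ?L"
  proof (rule comm_monoidI)
    fix x y assume "x \<in> carrier ?L" "y \<in> carrier ?L"
    then show "x \<otimes>\<^bsub>?L\<^esub> y \<in> carrier ?L" "x \<otimes>\<^bsub>?L\<^esub> y = y \<otimes>\<^bsub>?L\<^esub> x"
      by (elim loc_frac_cases, simp add: ops m_comm)+
  next
    show "\<one>\<^bsub>?L\<^esub> \<in> carrier ?L" by (simp add: ops)
  next
    fix x assume "x \<in> carrier ?L"
    then show "\<one>\<^bsub>?L\<^esub> \<otimes>\<^bsub>?L\<^esub> x = x" by (elim loc_frac_cases) (simp add: ops)
  next
    fix x y z assume "x \<in> carrier ?L" "y \<in> carrier ?L" "z \<in> carrier ?L"
    then show "(x \<otimes>\<^bsub>?L\<^esub> y) \<otimes>\<^bsub>?L\<^esub> z = x \<otimes>\<^bsub>?L\<^esub> (y \<otimes>\<^bsub>?L\<^esub> z)"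
      by (elim loc_frac_cases) (simp add: ops m_assoc)
  qed
  fix x y z assume "x \<in> carrier ?L" "y \<in> carrier ?L" "z \<in> carrier ?L"
  then show "(x \<oplus>\<^bsub>?L\<^esub> y) \<otimes>\<^bsub>?L\<^esub> z = x \<otimes>\<^bsub>?L\<^esub> z \<oplus>\<^bsub>?L\<^esub> y \<otimes>\<^bsub>?L\<^esub> z"
  proof (elim loc_frac_cases)
    fix a s b t c r assume H: "x = loc_frac R S a s" "y = loc_frac R S b t" "z = loc_frac R S c r"
      "a \<in> carrier R" "b \<in> carrier R" "c \<in> carrier R" and T: "s \<in> S" "t \<in> S" "r \<in> S"
    note K = H(4-6) T[THEN S_carr]
    have E: "((a \<otimes> t \<oplus> b \<otimes> s) \<otimes> c) \<otimes> ((s \<otimes> r) \<otimes> (t \<otimes> r))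
      = ((a \<otimes> c) \<otimes> (t \<otimes> r) \<oplus> (b \<otimes> c) \<otimes> (s \<otimes> r)) \<otimes> (s \<otimes> t \<otimes> r)"
      using K by (simp add: l_distr r_distr m_ac a_ac)
    show ?thesis using H T by (simp add: ops) (rule loc_frac_eqI, simp_all only: E; simp)
  qed
qed

lemma loc_map_ring_hom: "(\<lambda>a. loc_frac R S a \<one>) \<in> ring_hom R (localization R S)"
  by (rule ring_hom_memI) (simp_all add: loc_frac_add loc_frac_mult loc_frac_one)

lemma loc_ideal_ideal:
  assumes "ideal J R"
  shows "ideal (loc_ideal R S J) (localization R S)"
proof -
  let ?L = "localization R S"
  interpret L: cring ?L by (rule cring_localization)
  interpret J: ideal J R by fact
  have carr: "loc_ideal R S J \<subseteq> carrier ?L"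
    by (auto simp: loc_ideal_def J.a_Hcarr)
  have absorb: "x \<otimes>\<^bsub>?L\<^esub> y \<in> loc_ideal R S J"
    if x: "x \<in> carrier ?L" and y: "y \<in> loc_ideal R S J" for x y
  proof -
    obtain b t where "x = loc_frac R S b t" "b \<in> carrier R" "t \<in> S" using x by (rule loc_frac_cases)
    moreover obtain a s where "y = loc_frac R S a s" "a \<in> J" "s \<in> S"
      using y by (auto simp: loc_ideal_def)
    moreover have "b \<otimes> a \<in> J" "t \<otimes> s \<in> S"
      using calculation by (auto simp: J.I_l_closed)
    ultimately show ?thesis
      by (auto simp: loc_ideal_def loc_frac_mult J.a_Hcarr)
  qed
  show ?thesis
  proof (rule idealI)
    show "ring ?L" ..
    show "subgroup (loc_ideal R S J) (add_monoid ?L)"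
    proof (rule L.add.subgroupI)
      show "loc_ideal R S J \<subseteq> carrier ?L" by (rule carr)
      have "loc_frac R S \<zero> \<one> \<in> loc_ideal R S J"
        by (force simp: loc_ideal_def)
      then show "loc_ideal R S J \<noteq> {}" by blast
    next
      fix x assume x: "x \<in> loc_ideal R S J"
      then have "\<ominus>\<^bsub>?L\<^esub> x = (\<ominus>\<^bsub>?L\<^esub> \<one>\<^bsub>?L\<^esub>) \<otimes>\<^bsub>?L\<^esub> x"
        using carr by (simp add: L.l_minus subset_iff)
      then show "\<ominus>\<^bsub>?L\<^esub> x \<in> loc_ideal R S J"
        using absorb[OF _ x] by simp
    next
      fix x y assume "x \<in> loc_ideal R S J" "y \<in> loc_ideal R S J"
      then obtain a s b t where "x = loc_frac R S a s" "a \<in> J" "s \<in> S" "y = loc_frac R S b t" "b \<in> J" "t \<in> S"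
        by (auto simp: loc_ideal_def)
      moreover have "a \<otimes> t \<oplus> b \<otimes> s \<in> J" "s \<otimes> t \<in> S"
        using calculation by (auto simp: J.I_r_closed)
      ultimately show "x \<oplus>\<^bsub>?L\<^esub> y \<in> loc_ideal R S J"
        by (auto simp: loc_ideal_def loc_frac_add J.a_Hcarr)
    qed
  next
    fix a x assume a: "a \<in> loc_ideal R S J" and x: "x \<in> carrier ?L"
    show "x \<otimes>\<^bsub>?L\<^esub> a \<in> loc_ideal R S J" using x a by (rule absorb)
    then show "a \<otimes>\<^bsub>?L\<^esub> x \<in> loc_ideal R S J"
      using a x carr by (simp add: L.m_comm subset_iff)
  qed
qed

lemma filtration_localization:
  assumes "filtration R I"
  shows "filtration (localization R S) (\<lambda>j. loc_ideal R S (I j))"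
proof -
  have "loc_ideal R S (I 0) = carrier (localization R S)"
    using assms by (auto simp: filtration_def carrier_localization loc_ideal_def)
  moreover have "ideal (loc_ideal R S (I j)) (localization R S)" for j
    using assms by (auto simp: filtration_def intro: loc_ideal_ideal)
  moreover have "loc_ideal R S (I (Suc j)) \<subseteq> loc_ideal R S (I j)" for j
    using assms unfolding filtration_def loc_ideal_def by blast
  ultimately show ?thesis by (simp add: filtration_def)
qed

end


section \<open>The completion and its natural map\<close>

lemma transition_coset:
  assumes "ideal J R" "ideal K R" "J \<subseteq> K" "a \<in> carrier R"
  shows "transition R K (J +>\<^bsub>R\<^esub> a) = K +>\<^bsub>R\<^esub> a"
proof -
  interpret J: ideal J R by fact
  interpret K: ideal K R by fact
  have "K +>\<^bsub>R\<^esub> x = K +>\<^bsub>R\<^esub> a" if "x \<in> J +>\<^bsub>R\<^esub> a" for x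
    using that assms(3,4) K.a_repr_independence'[of x a] by (auto simp: a_r_coset_def')
  moreover have "a \<in> J +>\<^bsub>R\<^esub> a" using assms(4) by (rule J.a_rcos_self)
  ultimately have "(\<Union>x\<in>J +>\<^bsub>R\<^esub> a. K +>\<^bsub>R\<^esub> x) = K +>\<^bsub>R\<^esub> a" by blast
  moreover have "K <+>\<^bsub>R\<^esub> A = (\<Union>x\<in>A. K +>\<^bsub>R\<^esub> x)" for A
    by (auto simp: set_add_def' a_r_coset_def')
  ultimately show ?thesis
    by (simp add: transition_def)
qed

lemma completion_map_closed:
  assumes "filtration R I" "a \<in> carrier R"
  shows "completion_map R I a \<in> carrier (completion R I)"
proof -
  have I: "ideal (I j) R" for j using assms(1) by (simp add: filtration_def)
  have mono: "I j \<subseteq> I i" if "i \<le> j" for i j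
    using lift_Suc_antimono_le[of I i j] assms(1) that by (simp add: filtration_def)
  have "transition R (I i) (I j +>\<^bsub>R\<^esub> a) = I i +>\<^bsub>R\<^esub> a" if "i \<le> j" for i j
    using I I mono[OF that] assms(2) by (rule transition_coset)
  moreover have "I j +>\<^bsub>R\<^esub> a \<in> carrier (R Quot I j)" for j
    using ring_hom_closed[OF ideal.rcos_ring_hom[OF I] assms(2)] .
  ultimately show ?thesis
    by (simp add: completion_def completion_map_def)
qed

lemma completion_map_ring_hom:
  assumes "filtration R I"
  shows "completion_map R I \<in> ring_hom R (completion R I)"
proof (rule ring_hom_memI)
  have I: "ideal (I j) R" for j using assms by (simp add: filtration_def)
  note hom = ideal.rcos_ring_hom[OF I]
  show "completion_map R I a \<in> carrier (completion R I)" if "a \<in> carrier R" for a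
    using assms that by (rule completion_map_closed)
  show "completion_map R I (a \<otimes>\<^bsub>R\<^esub> b)
      = completion_map R I a \<otimes>\<^bsub>completion R I\<^esub> completion_map R I b"
    "completion_map R I (a \<oplus>\<^bsub>R\<^esub> b)
      = completion_map R I a \<oplus>\<^bsub>completion R I\<^esub> completion_map R I b"
    if "a \<in> carrier R" "b \<in> carrier R" for a b
    using that by (simp_all add: completion_map_def completion_def fun_eq_iff
        ring_hom_mult[OF hom] ring_hom_add[OF hom])
  show "completion_map R I \<one>\<^bsub>R\<^esub> = \<one>\<^bsub>completion R I\<^esub>"
    by (simp add: completion_map_def completion_def fun_eq_iff ring_hom_one[OF hom])
qed

end

theory Submission
  imports Defs
begin

text \<open>
  Every \<open>s \<in> S\<close> is invertible modulo \<open>I\<^sub>\<infinity>\<close>, so \<open>R/I\<^sub>j \<rightarrow> R[S\<^sup>-\<^sup>1]/I\<^sub>j[S\<^sup>-\<^sup>1]\<close> is an isomorphism for every \<open>j\<close>,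
  and moreover each fraction is congruent to some \<open>a/1\<close> modulo all \<open>I\<^sub>j[S\<^sup>-\<^sup>1]\<close> at once. Both
  surjectivity statements say that coherent sequences have limits, and coherent sequences and
  their limits can be transported along \<open>a \<mapsto> a/1\<close> in either direction.
\<close>

text \<open>Surjectivity of the completion map, phrased with representatives in \<open>R\<close> in
  place of cosets, so that it can be carried along a ring homomorphism. The limit \<open>b\<close>
  need not be unique.\<close>

definition has_limits :: "('a, 'm) ring_scheme \<Rightarrow> (nat \<Rightarrow> 'a set) \<Rightarrow> bool"
  where "has_limits R I \<longleftrightarrow>
    (\<forall>a. (\<forall>j. a j \<in> carrier R) \<and> (\<forall>i j. i \<le> j \<longrightarrow> a j \<ominus>\<^bsub>R\<^esub> a i \<in> I i)
      \<longrightarrow> (\<exists>b\<in>carrier R. \<forall>j. b \<ominus>\<^bsub>R\<^esub> a j \<in> I j))"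

lemma has_limitsD:
  assumes "has_limits R I" "\<And>j. a j \<in> carrier R" "\<And>i j. i \<le> j \<Longrightarrow> a j \<ominus>\<^bsub>R\<^esub> a i \<in> I i"
  shows "\<exists>b\<in>carrier R. \<forall>j. b \<ominus>\<^bsub>R\<^esub> a j \<in> I j"
  using assms unfolding has_limits_def by blast

lemma filtration_mono:
  assumes "filtration R I" "i \<le> j"
  shows "I j \<subseteq> I i"
  using lift_Suc_antimono_le[of I i j] assms by (simp add: filtration_def)

text \<open>The transition map sends \<open>I j + a j\<close> to \<open>I i + a j\<close>, so
  compatibility at \<open>i \<le> j\<close> is the equality of two cosets of
  \<open>I i\<close>.\<close>

lemma coset_sequence_coherent_iff:
  assumes "filtration R I" "\<And>j. a j \<in> carrier R"
  shows "(\<lambda>j. I j +>\<^bsub>R\<^esub> a j) \<in> carrier (completion R I)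
    \<longleftrightarrow> (\<forall>i j. i \<le> j \<longrightarrow> a j \<ominus>\<^bsub>R\<^esub> a i \<in> I i)"
proof -
  have I: "ideal (I j) R" for j using assms(1) by (simp add: filtration_def)
  have "I j +>\<^bsub>R\<^esub> a j \<in> carrier (R Quot I j)" for j
    using ring_hom_closed[OF ideal.rcos_ring_hom[OF I] assms(2)] .
  moreover have "transition R (I i) (I j +>\<^bsub>R\<^esub> a j) = I i +>\<^bsub>R\<^esub> a i \<longleftrightarrow> a j \<ominus>\<^bsub>R\<^esub> a i \<in> I i"
    if "i \<le> j" for i j
    using that assms(2) ring.quotient_eq_iff_same_a_r_cos[OF ideal.axioms(2)[OF I] I]
    by (simp add: transition_coset[OF I I filtration_mono[OF assms(1)]])
  ultimately show ?thesis by (simp add: completion_def)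
qed

text \<open>Elements of the completion are the coset sequences of coherent sequences, and a preimage
  of such an element is the same thing as a limit.\<close>

lemma completion_map_surj_iff_has_limits:
  assumes "filtration R I"
  shows "completion_map R I ` carrier R = carrier (completion R I) \<longleftrightarrow> has_limits R I"
proof -
  have I: "ideal (I j) R" for j using assms by (simp add: filtration_def)
  have ring: "ring R" by (rule ideal.axioms(2)[OF I])
  have eq: "I j +>\<^bsub>R\<^esub> b = I j +>\<^bsub>R\<^esub> a \<longleftrightarrow> b \<ominus>\<^bsub>R\<^esub> a \<in> I j"
    if "a \<in> carrier R" "b \<in> carrier R" for a b j
    using ring.quotient_eq_iff_same_a_r_cos[OF ring I] that by simp
  show ?thesis
  proof
    assume surj: "completion_map R I ` carrier R = carrier (completion R I)"
    show "has_limits R I"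
      unfolding has_limits_def
    proof (intro allI impI, elim conjE)
      fix a assume a: "\<forall>j. a j \<in> carrier R" "\<forall>i j. i \<le> j \<longrightarrow> a j \<ominus>\<^bsub>R\<^esub> a i \<in> I i"
      then have "(\<lambda>j. I j +>\<^bsub>R\<^esub> a j) \<in> carrier (completion R I)"
        using coset_sequence_coherent_iff[OF assms] by blast
      then have "(\<lambda>j. I j +>\<^bsub>R\<^esub> a j) \<in> completion_map R I ` carrier R"
        unfolding surj .
      then obtain b where b: "b \<in> carrier R" "(\<lambda>j. I j +>\<^bsub>R\<^esub> a j) = (\<lambda>j. I j +>\<^bsub>R\<^esub> b)"
        unfolding completion_map_def by (rule imageE)
      then have "b \<ominus>\<^bsub>R\<^esub> a j \<in> I j" for j
        using a(1) eq[of "a j" b j] by (simp add: fun_eq_iff)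
      then show "\<exists>b\<in>carrier R. \<forall>j. b \<ominus>\<^bsub>R\<^esub> a j \<in> I j"
        using b(1) by (intro bexI allI)
    qed
  next
    assume lim: "has_limits R I"
    have "x \<in> completion_map R I ` carrier R" if x: "x \<in> carrier (completion R I)" for x
    proof -
      \<comment> \<open>Representatives are chosen separately for each \<open>j\<close>; their
        coherence comes afterwards from membership of \<open>x\<close> in the completion.\<close>
      have "\<forall>j. \<exists>c\<in>carrier R. x j = I j +>\<^bsub>R\<^esub> c"
        using x by (simp add: completion_def FactRing_def A_RCOSETS_def')
      then obtain a where "\<forall>j. a j \<in> carrier R \<and> x j = I j +>\<^bsub>R\<^esub> a j"
        unfolding Bex_def by (rule choice[THEN exE])
      then have a: "\<And>j. a j \<in> carrier R" "x = (\<lambda>j. I j +>\<^bsub>R\<^esub> a j)"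
        by auto
      have coh: "a j \<ominus>\<^bsub>R\<^esub> a i \<in> I i" if "i \<le> j" for i j
        using x that coset_sequence_coherent_iff[OF assms, of a] a by simp
      obtain b where b: "b \<in> carrier R" "\<forall>j. b \<ominus>\<^bsub>R\<^esub> a j \<in> I j"
        using has_limitsD[OF lim a(1) coh] by blast
      then have "completion_map R I b = x"
        using a eq by (simp add: completion_map_def fun_eq_iff)
      then show ?thesis using b(1) by blast
    qed
    then show "completion_map R I ` carrier R = carrier (completion R I)"
      using completion_map_closed[OF assms] by blast
  qed
qed

lemma (in ideal) diff_trans:
  assumes "x \<ominus> y \<in> I" "y \<ominus> z \<in> I" "x \<in> carrier R" "y \<in> carrier R" "z \<in> carrier R"
  shows "x \<ominus> z \<in> I"
proof -
  have "x \<ominus> z = (x \<ominus> y) \<oplus> (y \<ominus> z)"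
    using assms(3-5) by algebra
  then show ?thesis using assms(1,2) by simp
qed

lemma (in ideal) diff_sym:
  assumes "x \<ominus> y \<in> I" "x \<in> carrier R" "y \<in> carrier R"
  shows "y \<ominus> x \<in> I"
proof -
  have "y \<ominus> x = \<ominus> (x \<ominus> y)"
    using assms(2,3) by algebra
  then show ?thesis using assms(1) by simp
qed

text \<open>By \<open>preimage\<close>, \<open>f\<close> preserves and reflects congruences, hence
  coherence and limits. By \<open>dense\<close>, each element of \<open>L\<close> is replaced by an
  element of the image of \<open>f\<close> that agrees with it modulo all \<open>J j\<close> at
  once.\<close>

lemma has_limits_transfer:
  assumes f: "ring_hom_ring R L f" and "filtration R I" "filtration L J"
    and preimage: "\<And>a j. a \<in> carrier R \<Longrightarrow> f a \<in> J j \<longleftrightarrow> a \<in> I j"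
    and dense: "\<And>y. y \<in> carrier L \<Longrightarrow> \<exists>a\<in>carrier R. \<forall>j. f a \<ominus>\<^bsub>L\<^esub> y \<in> J j"
  shows "has_limits R I \<longleftrightarrow> has_limits L J"
proof -
  interpret f: ring_hom_ring R L f by (rule f)
  have J: "ideal (J j) L" for j using assms(3) by (simp add: filtration_def)
  note trans = ideal.diff_trans[OF J] and sym = ideal.diff_sym[OF J]
  have fdiff: "f a \<ominus>\<^bsub>L\<^esub> f b \<in> J j \<longleftrightarrow> a \<ominus>\<^bsub>R\<^esub> b \<in> I j"
    if "a \<in> carrier R" "b \<in> carrier R" for a b j
    using preimage[of "a \<ominus>\<^bsub>R\<^esub> b" j] that by (simp add: f.R.minus_eq f.S.minus_eq)
  show ?thesis
  proof
    assume lim: "has_limits R I"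
    show "has_limits L J"
      unfolding has_limits_def
    proof (intro allI impI, elim conjE)
      fix y assume y: "\<forall>j. y j \<in> carrier L" "\<forall>i j. i \<le> j \<longrightarrow> y j \<ominus>\<^bsub>L\<^esub> y i \<in> J i"
      then have "\<forall>k. \<exists>a\<in>carrier R. \<forall>j. f a \<ominus>\<^bsub>L\<^esub> y k \<in> J j"
        using dense by blast
      then obtain a where a: "\<And>k. a k \<in> carrier R" "\<And>k j. f (a k) \<ominus>\<^bsub>L\<^esub> y k \<in> J j"
        by metis
      \<comment> \<open>Modulo \<open>J i\<close> there is the chain \<open>f (a j)\<close>,
        \<open>y j\<close>, \<open>y i\<close>, \<open>f (a i)\<close>. Its first link lies in
        \<open>J i\<close> because \<open>a j\<close> approximates \<open>y j\<close> modulo every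
        ideal, not only modulo \<open>J j\<close>.\<close>
      have coh: "a j \<ominus>\<^bsub>R\<^esub> a i \<in> I i" if "i \<le> j" for i j
      proof -
        have "f (a j) \<ominus>\<^bsub>L\<^esub> y i \<in> J i"
          using trans[of "f (a j)" "y j" i "y i"] a y that by simp
        moreover have "y i \<ominus>\<^bsub>L\<^esub> f (a i) \<in> J i"
          using sym a y by simp
        ultimately show ?thesis
          using trans[of "f (a j)" "y i" i "f (a i)"] a y fdiff by simp
      qed
      obtain b where b: "b \<in> carrier R" "\<forall>j. b \<ominus>\<^bsub>R\<^esub> a j \<in> I j"
        using has_limitsD[OF lim a(1) coh] by blast
      then have "f b \<ominus>\<^bsub>L\<^esub> y j \<in> J j" for j
        using trans[of "f b" "f (a j)" j "y j"] a y fdiff by simp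
      then show "\<exists>b\<in>carrier L. \<forall>j. b \<ominus>\<^bsub>L\<^esub> y j \<in> J j"
        using b(1) f.hom_closed by blast
    qed
  next
    assume lim: "has_limits L J"
    show "has_limits R I"
      unfolding has_limits_def
    proof (intro allI impI, elim conjE)
      fix a assume a: "\<forall>j. a j \<in> carrier R" "\<forall>i j. i \<le> j \<longrightarrow> a j \<ominus>\<^bsub>R\<^esub> a i \<in> I i"
      have fa: "f (a j) \<in> carrier L" for j
        using a(1) by simp
      have coh: "f (a j) \<ominus>\<^bsub>L\<^esub> f (a i) \<in> J i" if "i \<le> j" for i j
        using a fdiff that by blast
      obtain y where y: "y \<in> carrier L" "\<forall>j. y \<ominus>\<^bsub>L\<^esub> f (a j) \<in> J j"
        using has_limitsD[OF lim fa coh] by blast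
      \<comment> \<open>The limit \<open>y\<close> may lie outside the image of \<open>f\<close>.
        Since one \<open>b\<close> serves for all \<open>j\<close>, \<open>f b\<close> is again a
        limit of the same sequence.\<close>
      then obtain b where b: "b \<in> carrier R" "\<forall>j. f b \<ominus>\<^bsub>L\<^esub> y \<in> J j"
        using dense by blast
      then have "f b \<ominus>\<^bsub>L\<^esub> f (a j) \<in> J j" for j
        using trans[of "f b" y j "f (a j)"] a y by simp
      then show "\<exists>b\<in>carrier R. \<forall>j. b \<ominus>\<^bsub>R\<^esub> a j \<in> I j"
        using a b(1) fdiff by blast
    qed
  qed
qed

context mult_closed
begin

text \<open>If \<open>a/1 = b/s\<close> with \<open>b \<in> J\<close>, then some
  \<open>u \<in> S\<close> gives \<open>u s a = u b \<in> J\<close>, and \<open>u s\<close> can be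
  cancelled because it is invertible modulo \<open>J\<close>.\<close>

lemma loc_frac_one_mem_loc_ideal_iff:
  assumes "ideal J R" "a \<in> carrier R"
    and inv: "\<And>q. q \<in> S \<Longrightarrow> \<exists>\<tau>\<in>J. \<exists>x\<in>carrier R. \<one> \<oplus> \<tau> = x \<otimes> q"
  shows "loc_frac R S a \<one> \<in> loc_ideal R S J \<longleftrightarrow> a \<in> J"
proof
  interpret J: ideal J R by fact
  assume "loc_frac R S a \<one> \<in> loc_ideal R S J"
  then obtain b s where b: "loc_frac R S a \<one> = loc_frac R S b s" "b \<in> J" "s \<in> S"
    by (auto simp: loc_ideal_def)
  then obtain u where u: "u \<in> S" "u \<otimes> (a \<otimes> s) = u \<otimes> (b \<otimes> \<one>)"
    using assms(2) J.a_Hcarr loc_frac_eq_iff[of a \<one> b s] by auto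
  \<comment> \<open>Inverting the product \<open>u \<otimes> s\<close> removes the denominator and
    the factor \<open>u\<close> from the equality of fractions together.\<close>
  obtain \<tau> x where x: "\<tau> \<in> J" "x \<in> carrier R" "\<one> \<oplus> \<tau> = x \<otimes> (u \<otimes> s)"
    using inv[of "u \<otimes> s"] u b by auto
  have carr: "\<tau> \<in> carrier R" "u \<in> carrier R" "s \<in> carrier R" "b \<in> carrier R"
    using x u b J.a_Hcarr by auto
  \<comment> \<open>Replacing \<open>\<one> \<oplus> \<tau>\<close> by
    \<open>x \<otimes> (u \<otimes> s)\<close> turns the first term into a multiple of
    \<open>b\<close>; the second is a multiple of \<open>\<tau>\<close>.\<close>
  have "a = (\<one> \<oplus> \<tau>) \<otimes> a \<ominus> a \<otimes> \<tau>"
    using carr assms(2) by algebra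
  also have "\<dots> = x \<otimes> (u \<otimes> (a \<otimes> s)) \<ominus> a \<otimes> \<tau>"
    unfolding x(3) using carr x(2) assms(2) by algebra
  also have "\<dots> = (x \<otimes> u) \<otimes> b \<ominus> a \<otimes> \<tau>"
    unfolding u(2) using carr x(2) assms(2) by algebra
  also have "\<dots> \<in> J"
    using b x carr assms(2) by (simp add: minus_eq J.I_l_closed)
  finally show "a \<in> J" .
next
  assume "a \<in> J"
  then show "loc_frac R S a \<one> \<in> loc_ideal R S J"
    unfolding loc_ideal_def using one_closed by blast
qed

lemma loc_frac_minus:
  assumes "a \<in> carrier R" "s \<in> S"
  shows "\<ominus>\<^bsub>localization R S\<^esub> loc_frac R S a s = loc_frac R S (\<ominus> a) s"
proof -
  interpret L: cring "localization R S" by (rule cring_localization)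
  have "loc_frac R S (\<ominus> a) s \<oplus>\<^bsub>localization R S\<^esub> loc_frac R S a s = \<zero>\<^bsub>localization R S\<^esub>"
    using assms loc_frac_eqI[of \<zero> "s \<otimes> s" \<zero> \<one>]
    by (simp add: loc_frac_add loc_frac_zero l_minus l_neg)
  then show ?thesis using assms by (simp add: L.minus_equality)
qed

text \<open>Modulo \<open>J\<close>, \<open>x\<close> is an inverse of \<open>s\<close>, so
  \<open>(a x)/1\<close> approximates \<open>a/s\<close>; the error is exactly
  \<open>(a \<tau>)/s\<close>.\<close>

lemma loc_frac_diff_mem_loc_ideal:
  assumes "ideal J R" "a \<in> carrier R" "s \<in> S" "x \<in> carrier R" "\<tau> \<in> J" "\<one> \<oplus> \<tau> = x \<otimes> s"
  shows "loc_frac R S (a \<otimes> x) \<one> \<ominus>\<^bsub>localization R S\<^esub> loc_frac R S a s \<in> loc_ideal R S J"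
proof -
  interpret J: ideal J R by fact
  interpret L: cring "localization R S" by (rule cring_localization)
  have carr: "\<tau> \<in> carrier R" "s \<in> carrier R" using assms J.a_Hcarr by auto
  \<comment> \<open>The left side is the numerator that \<open>loc_frac_add\<close> produces for
    \<open>(a x)/1 + (- a)/s\<close>.\<close>
  have "a \<otimes> x \<otimes> s \<oplus> (\<ominus> a) \<otimes> \<one> = a \<otimes> (x \<otimes> s) \<ominus> a"
    using carr assms(2,4) by algebra
  also have "\<dots> = a \<otimes> \<tau>"
    unfolding assms(6)[symmetric] using carr assms(2) by algebra
  finally have "loc_frac R S (a \<otimes> x) \<one> \<ominus>\<^bsub>localization R S\<^esub> loc_frac R S a s = loc_frac R S (a \<otimes> \<tau>) s"
    using assms carr by (simp add: L.minus_eq loc_frac_minus loc_frac_add)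
  moreover have "a \<otimes> \<tau> \<in> J" using assms by (simp add: J.I_l_closed)
  ultimately show ?thesis using assms(3) by (auto simp: loc_ideal_def)
qed

end

theorem lemma2p10:
  fixes R (structure) and S :: "'a set" and I :: "nat \<Rightarrow> 'a set"
  assumes "cring R"
    and "submonoid S R"
    and "filtration R I"
    and "(\<Inter>j. I j) \<inter> S = {}"
    and "\<And>q. q \<in> S \<Longrightarrow> \<exists>\<tau>\<in>(\<Inter>j. I j). \<one> \<oplus> \<tau> \<in> PIdl q"
  shows "completion_map R I ` carrier R = carrier (completion R I)
    \<longleftrightarrow> completion_map (localization R S) (\<lambda>j. loc_ideal R S (I j)) ` carrier (localization R S)
          = carrier (completion (localization R S) (\<lambda>j. loc_ideal R S (I j)))"
proof -
  interpret mult_closed R S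
    using assms(1,2) by (simp add: mult_closed_def)
  interpret L: cring "localization R S" by (rule cring_localization)
  have I: "ideal (I j) R" for j using assms(3) by (simp add: filtration_def)
  have inv: "\<exists>\<tau>\<in>(\<Inter>j. I j). \<exists>x\<in>carrier R. \<one> \<oplus> \<tau> = x \<otimes> q" if "q \<in> S" for q
    using assms(5)[OF that] by (auto simp: cgenideal_def)
  note filt = filtration_localization[OF assms(3)]
  have "has_limits R I \<longleftrightarrow> has_limits (localization R S) (\<lambda>j. loc_ideal R S (I j))"
  proof (rule has_limits_transfer[OF _ assms(3) filt])
    show "ring_hom_ring R (localization R S) (\<lambda>a. loc_frac R S a \<one>)"
      using loc_map_ring_hom ring_axioms L.ring_axioms by (intro ring_hom_ringI2)
    \<comment> \<open>An inverse modulo the intersection is an inverse modulo each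
      \<open>I j\<close>.\<close>
    show "loc_frac R S a \<one> \<in> loc_ideal R S (I j) \<longleftrightarrow> a \<in> I j" if "a \<in> carrier R" for a j
      using I that by (rule loc_frac_one_mem_loc_ideal_iff) (use inv in blast)
    show "\<exists>a\<in>carrier R. \<forall>j. loc_frac R S a \<one> \<ominus>\<^bsub>localization R S\<^esub> y \<in> loc_ideal R S (I j)"
      if "y \<in> carrier (localization R S)" for y
    proof -
      from that obtain a s where y: "y = loc_frac R S a s" "a \<in> carrier R" "s \<in> S"
        by (rule loc_frac_cases)
      \<comment> \<open>Both \<open>\<tau>\<close> and \<open>x\<close> are fixed before
        \<open>j\<close>: since \<open>\<tau>\<close> lies in every \<open>I j\<close>, the single
        element \<open>a \<otimes> x\<close> approximates \<open>y\<close> modulo all the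
        ideals.\<close>
      obtain \<tau> x where x: "\<tau> \<in> (\<Inter>j. I j)" "x \<in> carrier R" "\<one> \<oplus> \<tau> = x \<otimes> s"
        using inv[OF y(3)] by blast
      then have "\<tau> \<in> I j" for j by blast
      then have "loc_frac R S (a \<otimes> x) \<one> \<ominus>\<^bsub>localization R S\<^esub> y \<in> loc_ideal R S (I j)" for j
        unfolding y(1) using loc_frac_diff_mem_loc_ideal[OF I y(2,3) x(2) _ x(3)] by blast
      moreover have "a \<otimes> x \<in> carrier R" using y(2) x(2) by simp
      ultimately show ?thesis by blast
    qed
  qed
  then show ?thesis
    by (simp add: completion_map_surj_iff_has_limits[OF assms(3)]
        completion_map_surj_iff_has_limits[OF filt])
qed

end
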